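(* Let $(\mathcal{P},\mathcal{H})$ be an intersection-closed hypothesis space whose collection $\{H_P:P\in\mathcal{P}\}$ of least hypotheses is at most countable. Let $(\varepsilon_t)_{t\ge0}$ be an E-capacity process. Then its closure $$\overline{\varepsilon}_t(H\mid x):=\inf_{P\in H}\varepsilon_t(H_P\mid x),\quad H\in\mathcal{H},$$ defines an E-measure process that dominates $(\varepsilon_t)_{t\ge0}$, i.e. $\overline{\varepsilon}_t(H\mid x)\ge\varepsilon_t(H\mid x)$ for all $t$, $H$, $x$. Moreover, $(\overline{\varepsilon}_t)_{t\ge0}$ is anytime valid if and only if $(\varepsilon_t)_{t\ge0}$ is anytime valid.
   Context: $(\mathcal{X},\Sigma)$ is a measurable space, $\mathcal{P}$ a collection of probability measures on it, and $(\mathcal{F}_t)_{t\ge0}$, $t\in\mathbb{N}=\{0,1,2,\dots\}$, a filtration of sub-$\sigma$-algebras of $\Sigma$. A hypothesis class $\mathcal{H}$ is a collection of subsets of $\mathcal{P}$ closed under arbitrary unions (including the empty union, so $\emptyset\in\mathcal{H}$); $(\mathcal{P},\mathcal{H})$ is then a hypothesis space. It is intersection-closed if $\mathcal{H}$ is also closed under arbitrary intersections and $\mathcal{P}\in\mathcal{H}$. In that case the least hypothesis of $P\in\mathcal{P}$ is $H_P=\bigcap\{H\in\mathcal{H}:P\in H\}\in\mathcal{H}$. An E-capacity is a map $\varepsilon:\mathcal{H}\to[0,\infty]$ with $\varepsilon(\emptyset)=\infty$ and $\varepsilon(H')\le\varepsilon(H)$ whenever $H\subseteq H'$, $H,H'\in\mathcal{H}$.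 An E-measure is a map $\varepsilon:\mathcal{H}\to[0,\infty]$ with $\varepsilon(\bigcup_{H\in\mathcal{S}}H)=\inf_{H\in\mathcal{S}}\varepsilon(H)$ for every $\mathcal{S}\subseteq\mathcal{H}$ (with $\inf\emptyset=\infty$). An E-capacity process (resp. E-measure process) is a family $(\varepsilon_t)_{t\ge0}$ of maps $\varepsilon_t:\mathcal{H}\times\mathcal{X}\to[0,\infty]$ such that $H\mapsto\varepsilon_t(H\mid x)$ is an E-capacity (resp. E-measure) for every $t\ge0$ and $x\in\mathcal{X}$, and $x\mapsto\varepsilon_t(H\mid x)$ is $\mathcal{F}_t$-measurable for every $t\ge0$ and $H\in\mathcal{H}$. Such a process is anytime valid if, for every stopping time $\tau:\mathcal{X}\to\mathbb{N}$ with respect to $(\mathcal{F}_t)_{t\ge0}$, the stopped kernel $\varepsilon_\tau(H\mid x):=\varepsilon_{\tau(x)}(H\mid x)$ is valid, i.e. $\mathbb{E}^P[\varepsilon_\tau(H\mid X)]\le1$ for every nonempty $H\in\mathcal{H}$ and every $P\in H$, where $\mathbb{E}^P$ is expectation when $X$ has law $P$. *)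

theory Defs
  imports "HOL-Probability.Probability"
begin

(* Members of space (prob_algebra M) are the probability measures on the sigma-algebra of M. *)
definition hypothesis_space ::
  "'a measure \<Rightarrow> 'a measure set \<Rightarrow> 'a measure set set \<Rightarrow> bool" where
  "hypothesis_space M \<P> \<H> \<longleftrightarrow>
     \<P> \<subseteq> space (prob_algebra M) \<and> \<H> \<subseteq> Pow \<P> \<and> (\<forall>\<S>\<subseteq>\<H>. \<Union>\<S> \<in> \<H>)"

(* The intersection of the empty family, taken inside \<P>, is \<P>; in HOL it would be UNIV,
   so that case is covered by \<P> \<in> \<H>. *)
definition intersection_closed :: "'p set \<Rightarrow> 'p set set \<Rightarrow> bool" where
  "intersection_closed \<P> \<H> \<longleftrightarrow>
     \<P> \<in> \<H> \<and> (\<forall>\<S>\<subseteq>\<H>. \<S> \<noteq> {} \<longrightarrow> \<Inter>\<S> \<in> \<H>)"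

definition least_hypothesis :: "'p set set \<Rightarrow> 'p \<Rightarrow> 'p set" where
  "least_hypothesis \<H> P = \<Inter>{H \<in> \<H>. P \<in> H}"

definition E_capacity :: "'p set set \<Rightarrow> ('p set \<Rightarrow> ennreal) \<Rightarrow> bool" where
  "E_capacity \<H> \<epsilon> \<longleftrightarrow>
     \<epsilon> {} = \<infinity> \<and> (\<forall>H\<in>\<H>. \<forall>H'\<in>\<H>. H \<subseteq> H' \<longrightarrow> \<epsilon> H' \<le> \<epsilon> H)"

(* In ennreal the infimum of the empty set is \<infinity>. *)
definition E_measure :: "'p set set \<Rightarrow> ('p set \<Rightarrow> ennreal) \<Rightarrow> bool" where
  "E_measure \<H> \<epsilon> \<longleftrightarrow> (\<forall>\<S>\<subseteq>\<H>. \<epsilon> (\<Union>\<S>) = (INF H\<in>\<S>. \<epsilon> H))"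

(* \<epsilon> t H x stands for \<epsilon>_t(H | x); only H \<in> \<H> and x \<in> space M matter. *)
definition E_capacity_process ::
  "'a measure \<Rightarrow> (nat \<Rightarrow> 'a measure) \<Rightarrow> 'p set set \<Rightarrow> (nat \<Rightarrow> 'p set \<Rightarrow> 'a \<Rightarrow> ennreal) \<Rightarrow> bool" where
  "E_capacity_process M F \<H> \<epsilon> \<longleftrightarrow>
     (\<forall>t. \<forall>x\<in>space M. E_capacity \<H> (\<lambda>H. \<epsilon> t H x)) \<and>
     (\<forall>t. \<forall>H\<in>\<H>. \<epsilon> t H \<in> borel_measurable (F t))"

definition E_measure_process ::
  "'a measure \<Rightarrow> (nat \<Rightarrow> 'a measure) \<Rightarrow> 'p set set \<Rightarrow> (nat \<Rightarrow> 'p set \<Rightarrow> 'a \<Rightarrow> ennreal) \<Rightarrow> bool" where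
  "E_measure_process M F \<H> \<epsilon> \<longleftrightarrow>
     (\<forall>t. \<forall>x\<in>space M. E_measure \<H> (\<lambda>H. \<epsilon> t H x)) \<and>
     (\<forall>t. \<forall>H\<in>\<H>. \<epsilon> t H \<in> borel_measurable (F t))"

(* The variable x ranges over the sample space, so its law under P is P itself. *)
definition valid_kernel ::
  "'a measure set set \<Rightarrow> ('a measure set \<Rightarrow> 'a \<Rightarrow> ennreal) \<Rightarrow> bool" where
  "valid_kernel \<H> \<kappa> \<longleftrightarrow> (\<forall>H\<in>\<H>. H \<noteq> {} \<longrightarrow> (\<forall>P\<in>H. (\<integral>\<^sup>+ x. \<kappa> H x \<partial>P) \<le> 1))"

definition anytime_valid ::
  "(nat \<Rightarrow> 'a measure) \<Rightarrow> 'a measure set set \<Rightarrow> (nat \<Rightarrow> 'a measure set \<Rightarrow> 'a \<Rightarrow> ennreal) \<Rightarrow> bool" where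
  "anytime_valid F \<H> \<epsilon> \<longleftrightarrow>
     (\<forall>\<tau> :: 'a \<Rightarrow> nat. stopping_time F \<tau> \<longrightarrow> valid_kernel \<H> (\<lambda>H x. \<epsilon> (\<tau> x) H x))"

definition process_closure ::
  "'p set set \<Rightarrow> (nat \<Rightarrow> 'p set \<Rightarrow> 'a \<Rightarrow> ennreal) \<Rightarrow> nat \<Rightarrow> 'p set \<Rightarrow> 'a \<Rightarrow> ennreal" where
  "process_closure \<H> \<epsilon> t H x = (INF P\<in>H. \<epsilon> t (least_hypothesis \<H> P) x)"

end

theory Submission
  imports Defs
begin

text \<open>The closure replaces the value at \<open>H\<close> by the smallest value among the least
  hypotheses of the points of \<open>H\<close>. An infimum over points turns unions into infima,
  which gives the E-measure property. Countably many least hypotheses keep the infimum measurable.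
  If \<open>P\<close> lies in \<open>H\<close>, then the least hypothesis of \<open>P\<close> is
  contained in \<open>H\<close>, so antitonicity gives domination
  (\<open>process_closure_ge\<close>). Validity survives because, under a fixed \<open>P\<close>,
  the closure at \<open>H\<close> is at most the original process at a hypothesis that still
  contains \<open>P\<close> (\<open>valid_kernel_process_closure\<close>); the converse is
  domination. All bounds are pointwise in time and sample point, hence persist under
  stopping.\<close>

lemma least_hypothesis_in:
  assumes "intersection_closed \<P> \<H>" "P \<in> \<P>"
  shows "least_hypothesis \<H> P \<in> \<H>" "P \<in> least_hypothesis \<H> P"
proof -
  \<comment> \<open>The witness is \<P> itself; closure under intersections is only granted for
    nonempty families.\<close>
  have "{H \<in> \<H>. P \<in> H} \<noteq> {}" "{H \<in> \<H>. P \<in> H} \<subseteq> \<H>"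
    using assms by (auto simp: intersection_closed_def)
  then show "least_hypothesis \<H> P \<in> \<H>"
    using assms(1) unfolding intersection_closed_def least_hypothesis_def by meson
qed (simp add: least_hypothesis_def)

lemma least_hypothesis_subset:
  assumes "H \<in> \<H>" "P \<in> H"
  shows "least_hypothesis \<H> P \<subseteq> H"
  using assms by (auto simp: least_hypothesis_def)

text \<open>An infimum over the points of a union is the infimum of the infima over its members; the
  empty union gives the top element.\<close>

lemma E_measure_process_closure: "E_measure \<H> (\<lambda>H. process_closure \<H> \<epsilon> t H x)"
  unfolding E_measure_def process_closure_def
  by (intro allI impI antisym INF_greatest) (auto intro: INF_lower INF_lower2)

lemma measurable_process_closure:
  assumes "countable (least_hypothesis \<H> ` H)"
    and "\<And>P. P \<in> H \<Longrightarrow> \<epsilon> t (least_hypothesis \<H> P) \<in> borel_measurable N"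
  shows "process_closure \<H> \<epsilon> t H \<in> borel_measurable N"
proof -
  \<comment> \<open>\<open>H\<close> may be uncountable, but the terms depend on \<open>P\<close>
    only through its least hypothesis, so the index set can be taken countable.\<close>
  have "process_closure \<H> \<epsilon> t H = (\<lambda>x. INF G\<in>least_hypothesis \<H> ` H. \<epsilon> t G x)"
    by (simp add: process_closure_def fun_eq_iff image_image)
  also have "\<dots> \<in> borel_measurable N"
    using assms by (intro borel_measurable_INF) auto
  finally show ?thesis .
qed

lemma process_closure_ge:
  assumes "intersection_closed \<P> \<H>" "H \<in> \<H>" "H \<subseteq> \<P>" "E_capacity \<H> (\<lambda>H. \<epsilon> t H x)"
  shows "\<epsilon> t H x \<le> process_closure \<H> \<epsilon> t H x"
  unfolding process_closure_def
proof (rule INF_greatest)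
  fix P assume "P \<in> H"
  then show "\<epsilon> t H x \<le> \<epsilon> t (least_hypothesis \<H> P) x"
    using assms least_hypothesis_in(1)[OF assms(1)] least_hypothesis_subset[of H \<H> P]
    by (auto simp: E_capacity_def)
qed

lemma process_closure_le:
  "P \<in> H \<Longrightarrow> process_closure \<H> \<epsilon> t H x \<le> \<epsilon> t (least_hypothesis \<H> P) x"
  unfolding process_closure_def by (rule INF_lower)

lemma valid_kernel_mono:
  assumes "\<And>H P x. H \<in> \<H> \<Longrightarrow> P \<in> H \<Longrightarrow> x \<in> space P \<Longrightarrow> \<kappa> H x \<le> \<kappa>' H x"
    and "valid_kernel \<H> \<kappa>'"
  shows "valid_kernel \<H> \<kappa>"
  unfolding valid_kernel_def
proof (intro ballI impI)
  fix H P assume "H \<in> \<H>" "P \<in> H"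
  then have "(\<integral>\<^sup>+ x. \<kappa> H x \<partial>P) \<le> (\<integral>\<^sup>+ x. \<kappa>' H x \<partial>P)"
    using assms(1) by (intro nn_integral_mono)
  also have "\<dots> \<le> 1"
    using assms(2) \<open>H \<in> \<H>\<close> \<open>P \<in> H\<close> by (auto simp: valid_kernel_def)
  finally show "(\<integral>\<^sup>+ x. \<kappa> H x \<partial>P) \<le> 1" .
qed

text \<open>For each \<open>P\<close> in \<open>H\<close>, validity of the original kernel is
  applied at the least hypothesis of \<open>P\<close> instead of at \<open>H\<close>; this is
  legitimate because that hypothesis belongs to \<H> and contains \<open>P\<close>.\<close>

lemma valid_kernel_process_closure:
  assumes "intersection_closed \<P> \<H>" "\<H> \<subseteq> Pow \<P>"
    and "valid_kernel \<H> (\<lambda>H x. \<epsilon> (\<tau> x) H x)"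
  shows "valid_kernel \<H> (\<lambda>H x. process_closure \<H> \<epsilon> (\<tau> x) H x)"
  unfolding valid_kernel_def
proof (intro ballI impI)
  fix H P assume "H \<in> \<H>" "P \<in> H"
  then have lh: "least_hypothesis \<H> P \<in> \<H>" "P \<in> least_hypothesis \<H> P"
    using assms(2) least_hypothesis_in[OF assms(1)] by auto
  \<comment> \<open>The competitor \<open>P\<close> in the infimum is the same for all
    \<open>x\<close>, so the bounding hypothesis does not vary with the random time.\<close>
  have "(\<integral>\<^sup>+ x. process_closure \<H> \<epsilon> (\<tau> x) H x \<partial>P)
      \<le> (\<integral>\<^sup>+ x. \<epsilon> (\<tau> x) (least_hypothesis \<H> P) x \<partial>P)"
    using \<open>P \<in> H\<close> by (intro nn_integral_mono process_closure_le)
  also have "\<dots> \<le> 1"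
    using assms(3) lh by (auto simp: valid_kernel_def)
  finally show "(\<integral>\<^sup>+ x. process_closure \<H> \<epsilon> (\<tau> x) H x \<partial>P) \<le> 1" .
qed

theorem theorem9:
  fixes M :: "'a measure"
    and F :: "nat \<Rightarrow> 'a measure"
    and \<P> :: "'a measure set"
    and \<H> :: "'a measure set set"
    and \<epsilon> :: "nat \<Rightarrow> 'a measure set \<Rightarrow> 'a \<Rightarrow> ennreal"
  assumes "filtration (space M) F"
    and "\<And>t. subalgebra M (F t)"
    and "hypothesis_space M \<P> \<H>"
    and "intersection_closed \<P> \<H>"
    and "countable {least_hypothesis \<H> P | P. P \<in> \<P>}"
    and "E_capacity_process M F \<H> \<epsilon>"
  shows "E_measure_process M F \<H> (process_closure \<H> \<epsilon>)
    \<and> (\<forall>t. \<forall>H\<in>\<H>. \<forall>x\<in>space M. process_closure \<H> \<epsilon> t H x \<ge> \<epsilon> t H x)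
    \<and> (anytime_valid F \<H> (process_closure \<H> \<epsilon>) \<longleftrightarrow> anytime_valid F \<H> \<epsilon>)"
proof -
  have sub: "\<H> \<subseteq> Pow \<P>" and prob: "\<P> \<subseteq> space (prob_algebra M)"
    using assms(3) by (auto simp: hypothesis_space_def)
  have meas: "process_closure \<H> \<epsilon> t H \<in> borel_measurable (F t)" if "H \<in> \<H>" for t H
  proof (rule measurable_process_closure)
    show "countable (least_hypothesis \<H> ` H)"
      by (rule countable_subset[OF _ assms(5)]) (use sub that in auto)
    show "\<epsilon> t (least_hypothesis \<H> P) \<in> borel_measurable (F t)" if "P \<in> H" for P
    proof -
      have "least_hypothesis \<H> P \<in> \<H>"
        using sub \<open>H \<in> \<H>\<close> that by (intro least_hypothesis_in(1)[OF assms(4)]) auto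
      then show ?thesis
        using assms(6) by (simp add: E_capacity_process_def)
    qed
  qed
  have dom: "\<epsilon> t H x \<le> process_closure \<H> \<epsilon> t H x" if "H \<in> \<H>" "x \<in> space M" for t H x
    using assms(6) sub that by (intro process_closure_ge[OF assms(4)]) (auto simp: E_capacity_process_def)
  \<comment> \<open>Domination is known only on \<open>space M\<close>, whereas
    \<open>valid_kernel_mono\<close> compares kernels on \<open>space P\<close>.\<close>
  have sp: "space P = space M" if "H \<in> \<H>" "P \<in> H" for H P
  proof (rule sets_eq_imp_space_eq)
    show "sets P = sets M"
      using sub prob that by (auto simp: space_prob_algebra)
  qed
  have "valid_kernel \<H> (\<lambda>H x. process_closure \<H> \<epsilon> (\<tau> x) H x) \<longleftrightarrow>
      valid_kernel \<H> (\<lambda>H x. \<epsilon> (\<tau> x) H x)" for \<tau>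
    using valid_kernel_process_closure[OF assms(4) sub]
      valid_kernel_mono[of \<H> "\<lambda>H x. \<epsilon> (\<tau> x) H x" "\<lambda>H x. process_closure \<H> \<epsilon> (\<tau> x) H x"]
    by (auto simp: sp dom)
  then have "anytime_valid F \<H> (process_closure \<H> \<epsilon>) \<longleftrightarrow> anytime_valid F \<H> \<epsilon>"
    by (simp add: anytime_valid_def)
  with meas dom show ?thesis
    by (auto simp: E_measure_process_def E_measure_process_closure)
qed

end
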